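(* Fix an integer $k\ge 1$. For every integer $n\ge 0$, the number of partitions of $n$ satisfying condition (P) equals the number of partitions of $n$ satisfying condition (S), where: (P) every part is either a multiple of $3$ or congruent to $-4$ or $-2 \pmod{3k+3}$. (S) all of the following hold: - the difference between adjacent parts is never $1$; - if the difference between two adjacent parts is in $\{2,5,\dots,3k-4\}$, then the smaller of these parts is $\not\equiv 0 \pmod 3$; - if the difference between two adjacent parts is in $\{4,7,\dots,3k-2\}$, then the smaller of these parts is $\equiv 2 \pmod 3$; - (initial condition, given by a fictitious zero) no part is equal to any of $1,4,\dots,3k-2$ or any of $2,5,\dots,3k-4$. Moreover, the generating function of the partitions satisfying (P) is the periodic infinite product $\prod_m (1-q^m)^{-1}$ over all $m\ge1$ with $3\mid m$ or $m\equiv-4,-2\pmod{3k+3}$; and a partition satisfies (S) if and only if its conjugate satisfies the following condition (C): (C) all of the following hold: - no part appears exactly once; - if the frequency of a part belongs to $\{2,5,8,\dots,3k-4\}$, then the number of parts strictly greater than it is $\not\equiv 0\pmod 3$; - if the frequency of a part belongs to $\{4,7,10,\dots,3k-2\}$, then the number of parts strictly greater than it is $\equiv 2\pmod 3$.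
   Context: Partitions $\lambda=(\lambda_1\ge\lambda_2\ge\dots\ge\lambda_r)$ have positive integer parts; adjacent parts are $\lambda_i,\lambda_{i+1}$ for $1\le i<r$. The sets $\{2,5,\dots,3k-4\}$, $\{4,7,\dots,3k-2\}$ and the list $1,4,\dots,3k-2$ are arithmetic progressions with common difference $3$ (the first two are empty when $k=1$). The initial condition is "given by a fictitious zero" if it is what the difference conditions impose when one part equal to $0$ is appended to the partition. The frequency of a part is the number of times it occurs; numbers of parts are counted with multiplicity. The conjugate of a partition is obtained by transposing its Ferrers diagram. *)

theory Defs
  imports "HOL-Number_Theory.Cong" "HOL-Analysis.Infinite_Products"
    "HOL-Computational_Algebra.Formal_Power_Series"
begin

text \<open>A partition is the list of its (positive) parts in weakly decreasing order.\<close>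

definition is_partition :: "nat list \<Rightarrow> bool" where
  "is_partition xs \<longleftrightarrow> sorted_wrt (\<ge>) xs \<and> (\<forall>x\<in>set xs. 0 < x)"

definition partitions :: "nat \<Rightarrow> nat list set" where
  "partitions n = {xs. is_partition xs \<and> sum_list xs = n}"

lemma finite_partitions: "finite (partitions n)"
proof (rule finite_subset)
  have "length xs \<le> sum_list xs" if "\<forall>x\<in>set xs. 0 < x" for xs :: "nat list"
    using that by (induction xs) auto
  then show "partitions n \<subseteq> {xs. set xs \<subseteq> {..n} \<and> length xs \<le> n}"
    by (auto simp: partitions_def is_partition_def intro: member_le_sum_list)
  show "finite {xs. set xs \<subseteq> {..n} \<and> length xs \<le> n}"
    by (rule finite_lists_length_le) simp
qed

text \<open>The Ferrers diagram is the list of its rows of dots; a dot is the unit element.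
  The lemma \<open>ferrers_conjugate\<close> below restates the transposition in terms of cells.\<close>

definition ferrers :: "nat list \<Rightarrow> unit list list" where
  "ferrers xs = map (\<lambda>x. replicate x ()) xs"

definition conjugate :: "nat list \<Rightarrow> nat list" where
  "conjugate xs = map length (List.transpose (ferrers xs))"

definition cells :: "nat list \<Rightarrow> (nat \<times> nat) set" where
  "cells xs = {(i, j). i < length xs \<and> j < xs ! i}"

lemma length_filter_gr_iff:
  fixes xs :: "nat list"
  assumes "sorted_wrt (\<ge>) xs"
  shows "i < length (filter (\<lambda>x. j < x) xs) \<longleftrightarrow> i < length xs \<and> j < xs ! i"
  using assms
proof (induction xs arbitrary: i)
  case (Cons x xs)
  show ?case
  proof (cases "j < x")
    case True
    then show ?thesis using Cons by (cases i) auto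
  next
    case False
    then have "filter (\<lambda>x. j < x) (x # xs) = []"
      using Cons.prems by (auto simp: filter_empty_conv)
    moreover have "\<not> (i < length (x # xs) \<and> j < (x # xs) ! i)"
      using False Cons.prems by (cases i) (auto simp: all_set_conv_all_nth)
    ultimately show ?thesis by (metis list.size(3) not_less_zero)
  qed
qed simp

lemma length_transpose_ferrers: "length (List.transpose (ferrers xs)) = foldr max xs 0"
  unfolding length_transpose ferrers_def by (induction xs) auto

lemma nth_conjugate:
  assumes "j < length (conjugate xs)"
  shows "conjugate xs ! j = length (filter (\<lambda>x. j < x) xs)"
  using assms
  by (simp add: conjugate_def nth_transpose ferrers_def filter_map comp_def)

lemma ferrers_conjugate:
  assumes "is_partition xs"
  shows "is_partition (conjugate xs)" and "cells (conjugate xs) = (cells xs)\<inverse>"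
proof -
  have s: "sorted_wrt (\<ge>) xs" using assms by (simp add: is_partition_def)
  have len: "j < length (conjugate xs) \<longleftrightarrow> (\<exists>x\<in>set xs. j < x)" for j
    unfolding conjugate_def length_map length_transpose_ferrers by (induction xs) (auto simp: less_max_iff_disj)
  show "is_partition (conjugate xs)"
    unfolding is_partition_def
  proof
    have *: "length (filter (\<lambda>x. j < x) xs) \<le> length (filter (\<lambda>x. i < x) xs)" if "i < j" for i j
      using that by (induction xs) auto
    show "sorted_wrt (\<ge>) (conjugate xs)"
      unfolding sorted_wrt_iff_nth_less using * by (auto simp: nth_conjugate)
    show "\<forall>x\<in>set (conjugate xs). 0 < x"
      unfolding all_set_conv_all_nth
      using len by (metis (mono_tags, lifting) filter_empty_conv length_greater_0_conv nth_conjugate)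
  qed
  show "cells (conjugate xs) = (cells xs)\<inverse>"
  proof -
    have "j < length (conjugate xs) \<and> i < conjugate xs ! j \<longleftrightarrow> i < length xs \<and> j < xs ! i" for i j
    proof (cases "j < length (conjugate xs)")
      case True
      then show ?thesis by (simp add: nth_conjugate length_filter_gr_iff[OF s])
    next
      case False
      then show ?thesis using len nth_mem by blast
    qed
    then show ?thesis by (auto simp: cells_def)
  qed
qed

text \<open>This depends only on \<open>m\<close> modulo \<open>3 k + 3\<close>, so the infinite product over the allowed \<open>m \<ge> 1\<close> is periodic.\<close>

definition allowed_part :: "nat \<Rightarrow> nat \<Rightarrow> bool" where
  "allowed_part k m \<longleftrightarrow>
     3 dvd m \<or> [int m = - 4] (mod (3 * int k + 3)) \<or> [int m = - 2] (mod (3 * int k + 3))"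

definition cond_P :: "nat \<Rightarrow> nat list \<Rightarrow> bool" where
  "cond_P k xs \<longleftrightarrow> (\<forall>x\<in>set xs. allowed_part k x)"

text \<open>For \<open>k \<ge> 1\<close>, the progressions \<open>{2, 5, \<dots>, 3 k - 4}\<close>, \<open>{4, 7, \<dots>, 3 k - 2}\<close>
  and \<open>{1, 4, \<dots>, 3 k - 2}\<close>; the first two are empty for \<open>k = 1\<close>.\<close>

definition prog2 :: "nat \<Rightarrow> nat set" where
  "prog2 k = (\<lambda>j. 3 * j + 2) ` {..<k - 1}"

definition prog4 :: "nat \<Rightarrow> nat set" where
  "prog4 k = (\<lambda>j. 3 * j + 1) ` {1..<k}"

definition prog1 :: "nat \<Rightarrow> nat set" where
  "prog1 k = (\<lambda>j. 3 * j + 1) ` {..<k}"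

text \<open>Subtraction of adjacent parts does not truncate, since partitions are decreasing.\<close>

definition cond_S :: "nat \<Rightarrow> nat list \<Rightarrow> bool" where
  "cond_S k xs \<longleftrightarrow>
     (\<forall>i. Suc i < length xs \<longrightarrow>
        xs ! i - xs ! Suc i \<noteq> 1 \<and>
        (xs ! i - xs ! Suc i \<in> prog2 k \<longrightarrow> \<not> [xs ! Suc i = 0] (mod 3)) \<and>
        (xs ! i - xs ! Suc i \<in> prog4 k \<longrightarrow> [xs ! Suc i = 2] (mod 3))) \<and>
     (\<forall>x\<in>set xs. x \<notin> prog1 k \<and> x \<notin> prog2 k)"

definition num_greater :: "nat list \<Rightarrow> nat \<Rightarrow> nat" where
  "num_greater xs x = length (filter (\<lambda>y. x < y) xs)"

definition cond_C :: "nat \<Rightarrow> nat list \<Rightarrow> bool" where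
  "cond_C k xs \<longleftrightarrow>
     (\<forall>x\<in>set xs.
        count_list xs x \<noteq> 1 \<and>
        (count_list xs x \<in> prog2 k \<longrightarrow> \<not> [num_greater xs x = 0] (mod 3)) \<and>
        (count_list xs x \<in> prog4 k \<longrightarrow> [num_greater xs x = 2] (mod 3)))"

end

theory Submission
  imports Defs "HOL-Library.More_List" "HOL-Library.Groups_Big_Fun"
begin

text \<open>Put \<open>N = 3 k + 3\<close> and continue partitions by zeros to functions on the naturals ("profiles").
  Write \<open>lift3 x = x + 2 (x mod 3)\<close>, a multiple of \<open>3\<close>. Checking the residues case by case,
  condition (S) with its fictitious zero says exactly that, for consecutive entries \<open>a \<ge> b\<close>,
  \<open>lift3 a \<ge> lift3 b\<close>, and even \<open>lift3 a \<ge> lift3 b + N\<close> when \<open>a mod 3 > b mod 3\<close>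
  (\<open>cond_S_iff_gapped\<close>).
  On the other side, the congruence classes \<open>0, -2, -4\<close> modulo \<open>N\<close> are \<open>{m. N dvd lift3 m}\<close>, and
  a weakly decreasing sequence of such numbers satisfies the same gap condition automatically
  (\<open>gapped_if_dvd_lift3\<close>).

  Both families are thus built in the same way. Fix the word of residues modulo \<open>3\<close>. The gap
  condition forces the lifted \<open>i\<close>-th entry to be at least \<open>N\<close> times the number of descents of the
  word from position \<open>i\<close> on, so that the smallest profile has total size \<open>N maj - 2 sum\<close> with the major
  index of the word. What exceeds the forced amount (\<open>surplus\<close>) is an arbitrary partition into
  multiples of \<open>3\<close> for (S), and an arbitrary partition into multiples of \<open>N\<close> for parts
  \<open>0, -2, -4\<close> modulo \<open>N\<close>. This is MacMahon's argument for the major index of words. Exchanging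
  the surplus against a free partition (\<open>bij_betw_trade\<close>) therefore gives, for generating functions,
  \<open>S * [multiples of N] = [0, -2, -4 mod N] * [multiples of 3]\<close>.
  Since \<open>-2\<close> and \<open>-4\<close> modulo \<open>N\<close> are never multiples of \<open>3\<close>, the right side is also
  \<open>P * [multiples of N]\<close>, and the common factor cancels.

  The infinite product is the limit of its finite truncations, which count partitions into bounded
  parts. The equivalence of (S) and (C) holds because in the conjugate the number of parts greater
  than \<open>i\<close> is the \<open>i\<close>-th entry of the original profile, so that frequencies are the differences of
  consecutive entries.\<close>

section \<open>Generating functions of weighted sets\<close>

definition gf :: "('a \<Rightarrow> nat) \<Rightarrow> 'a set \<Rightarrow> rat fps" where
  "gf w A = Abs_fps (\<lambda>n. of_nat (card {x \<in> A. w x = n}))"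

lemma gf_nth: "fps_nth (gf w A) n = of_nat (card {x \<in> A. w x = n})"
  by (simp add: gf_def)

lemma gf_bij_betw:
  assumes "bij_betw h A B" and "\<And>x. x \<in> A \<Longrightarrow> v (h x) = w x"
  shows "gf w A = gf v B"
proof -
  have "bij_betw h {x \<in> A. w x = n} {y \<in> B. v y = n}" for n
    using assms unfolding bij_betw_def inj_on_def by (auto simp: image_iff)
  then have "card {x \<in> A. w x = n} = card {y \<in> B. v y = n}" for n
    by (rule bij_betw_same_card)
  then show ?thesis by (simp add: gf_def)
qed

lemma gf_times:
  assumes "\<And>n. finite {x \<in> A. w x = n}" and "\<And>n. finite {y \<in> B. v y = n}"
  shows "gf w A * gf v B = gf (\<lambda>(x, y). w x + v y) (A \<times> B)"
proof (rule fps_ext)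
  fix n
  let ?F = "\<lambda>i. {x \<in> A. w x = i} \<times> {y \<in> B. v y = n - i}"
  have "{p \<in> A \<times> B. (case p of (x, y) \<Rightarrow> w x + v y) = n} = (\<Union>i\<in>{0..n}. ?F i)"
    by auto
  then have "card {p \<in> A \<times> B. (case p of (x, y) \<Rightarrow> w x + v y) = n} = (\<Sum>i=0..n. card (?F i))"
    using assms by (simp only:) (subst card_UN_disjoint, auto)
  then show "fps_nth (gf w A * gf v B) n = fps_nth (gf (\<lambda>(x, y). w x + v y) (A \<times> B)) n"
    by (simp add: fps_mult_nth gf_nth card_cartesian_product)
qed

section \<open>Partitions with parts in a given set\<close>

definition partitions_into :: "nat set \<Rightarrow> nat list set" where
  "partitions_into A = {xs. is_partition xs \<and> set xs \<subseteq> A}"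

lemma finite_partition_fibre:
  assumes "A \<subseteq> {xs. is_partition xs}"
  shows "finite {xs \<in> A. sum_list xs = n}"
  by (rule finite_subset[OF _ finite_partitions[of n]]) (use assms in \<open>auto simp: partitions_def\<close>)

lemma sort_partition:
  assumes "is_partition xs" shows "rev (sort xs) = xs"
proof -
  have "sorted (rev xs)" using assms by (simp add: is_partition_def sorted_wrt_rev)
  then have "sort (rev xs) = rev xs" by (rule sort_key_id_if_sorted[where f="\<lambda>x. x", simplified])
  moreover have "sort (rev xs) = sort xs" by (rule properties_for_sort) auto
  ultimately show ?thesis by simp
qed

text \<open>A partition into parts from a disjoint union is determined by its two subpartitions, and sorting
  merges any two of them back.\<close>

lemma gf_partitions_into_Un:
  assumes "A \<inter> B = {}"
  shows "gf sum_list (partitions_into (A \<union> B)) =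
    gf sum_list (partitions_into A) * gf sum_list (partitions_into B)"
proof -
  let ?split = "\<lambda>xs::nat list. (filter (\<lambda>x. x \<in> A) xs, filter (\<lambda>x. x \<in> B) xs)"
  let ?merge = "\<lambda>(xs::nat list, ys). rev (sort (xs @ ys))"
  have m: "mset (filter (\<lambda>x. x \<in> A) xs @ filter (\<lambda>x. x \<in> B) xs) = mset xs"
    if "set xs \<subseteq> A \<union> B" for xs
    using that assms by (induction xs) auto
  have fA: "filter (\<lambda>x. x \<in> A) xs = xs" "filter (\<lambda>x. x \<in> B) xs = []" if "set xs \<subseteq> A" for xs
    using that assms by (auto simp: filter_id_conv filter_empty_conv)
  have fB: "filter (\<lambda>x. x \<in> B) xs = xs" "filter (\<lambda>x. x \<in> A) xs = []" if "set xs \<subseteq> B" for xs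
    using that assms by (auto simp: filter_id_conv filter_empty_conv)
  have "bij_betw ?split (partitions_into (A \<union> B)) (partitions_into A \<times> partitions_into B)"
  proof (rule bij_betw_byWitness[where f' = ?merge])
    show "\<forall>xs\<in>partitions_into (A \<union> B). ?merge (?split xs) = xs"
    proof
      fix xs assume "xs \<in> partitions_into (A \<union> B)"
      then have "set xs \<subseteq> A \<union> B" and p: "is_partition xs" by (auto simp: partitions_into_def)
      then have "sort (filter (\<lambda>x. x \<in> A) xs @ filter (\<lambda>x. x \<in> B) xs) = sort xs"
        using m by (intro properties_for_sort) auto
      then show "?merge (?split xs) = xs" using sort_partition[OF p] by simp
    qed
    show "\<forall>p\<in>partitions_into A \<times> partitions_into B. ?split (?merge p) = p"
      by (auto simp: partitions_into_def filter_sort fA fB sort_partition simp flip: rev_filter)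
    show "?split ` partitions_into (A \<union> B) \<subseteq> partitions_into A \<times> partitions_into B"
      by (auto simp: partitions_into_def is_partition_def sorted_wrt_filter)
    show "?merge ` (partitions_into A \<times> partitions_into B) \<subseteq> partitions_into (A \<union> B)"
      by (auto simp: partitions_into_def is_partition_def sorted_wrt_rev)
  qed
  moreover have "sum_list xs = (case ?split xs of (ys, zs) \<Rightarrow> sum_list ys + sum_list zs)"
    if "xs \<in> partitions_into (A \<union> B)" for xs
    using arg_cong[OF m[of xs], of sum_mset] that
    by (simp add: partitions_into_def sum_mset_sum_list del: mset_append mset_filter)
  ultimately have "gf sum_list (partitions_into (A \<union> B)) =
      gf (\<lambda>(ys, zs). sum_list ys + sum_list zs) (partitions_into A \<times> partitions_into B)"
    by (intro gf_bij_betw) auto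
  also have "\<dots> = gf sum_list (partitions_into A) * gf sum_list (partitions_into B)"
    by (intro gf_times[symmetric] finite_partition_fibre) (auto simp: partitions_into_def)
  finally show ?thesis .
qed

lemma gf_partitions_into_singleton:
  assumes "0 < m"
  shows "gf sum_list (partitions_into {m}) = inverse (1 - fps_X ^ m)"
proof -
  have mem: "xs \<in> partitions_into {m} \<longleftrightarrow> (\<exists>j. xs = replicate j m)" for xs
  proof
    assume "xs \<in> partitions_into {m}"
    then have "xs = replicate (length xs) m"
      by (intro replicate_eqI) (auto simp: partitions_into_def)
    then show "\<exists>j. xs = replicate j m" by blast
  next
    assume "\<exists>j. xs = replicate j m"
    then show "xs \<in> partitions_into {m}"
      using assms by (auto simp: partitions_into_def is_partition_def sorted_wrt_iff_nth_less)
  qed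
  have "{xs \<in> partitions_into {m}. sum_list xs = n} =
      (if m dvd n then {replicate (n div m) m} else {})" for n
  proof (cases "m dvd n")
    case True
    then obtain j where "n = j * m" by (metis dvd_div_mult_self)
    then show ?thesis using assms by (auto simp: mem sum_list_replicate)
  next
    case False
    then show ?thesis by (auto simp: mem sum_list_replicate)
  qed
  then have nth: "fps_nth (gf sum_list (partitions_into {m})) n = of_bool (m dvd n)" for n
    by (simp add: gf_nth)
  have "(1 - fps_X ^ m) * gf sum_list (partitions_into {m}) = 1"
  proof (rule fps_ext)
    fix n
    show "fps_nth ((1 - fps_X ^ m) * gf sum_list (partitions_into {m})) n = fps_nth 1 n"
    proof (cases "n < m")
      case True
      then have "m dvd n \<longleftrightarrow> n = 0" by (auto dest: dvd_imp_le)
      then show ?thesis using True by (simp add: left_diff_distrib fps_X_power_mult_nth nth)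
    next
      case False
      then have "m dvd n - m \<longleftrightarrow> m dvd n" by (simp add: dvd_minus_self)
      then show ?thesis using False assms
        by (simp add: left_diff_distrib fps_X_power_mult_nth nth)
    qed
  qed
  then show ?thesis by (simp add: fps_inverse_unique)
qed

lemma gf_partitions_into_bounded:
  "(\<Prod>m\<le>n. if 1 \<le> m \<and> m \<in> A then inverse (1 - fps_X ^ m) else 1) =
    gf sum_list (partitions_into (A \<inter> {1..n}))"
proof (induction n)
  case 0
  have "{xs \<in> partitions_into {}. sum_list xs = n} = (if n = 0 then {[]} else {})" for n
    by (auto simp: partitions_into_def is_partition_def)
  then have "gf sum_list (partitions_into {}) = 1"
    by (simp add: gf_def fps_eq_iff)
  then show ?case by simp
next
  case (Suc n)
  have "gf sum_list (partitions_into (A \<inter> {1..Suc n})) =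
      gf sum_list (partitions_into (A \<inter> {1..n})) * inverse (1 - fps_X ^ Suc n)" if "Suc n \<in> A"
  proof -
    have "A \<inter> {1..Suc n} = (A \<inter> {1..n}) \<union> {Suc n}"
      using that by (simp add: atLeastAtMostSuc_conv)
    moreover have "(A \<inter> {1..n}) \<inter> {Suc n} = {}" by simp
    ultimately show ?thesis
      using gf_partitions_into_Un[of "A \<inter> {1..n}" "{Suc n}"]
        gf_partitions_into_singleton[of "Suc n"] by (simp only: zero_less_Suc)
  qed
  moreover have "A \<inter> {1..Suc n} = A \<inter> {1..n}" if "Suc n \<notin> A"
    using that by (simp add: atLeastAtMostSuc_conv)
  moreover have "1 \<le> Suc n" by simp
  ultimately show ?case
    unfolding prod.atMost_Suc Suc.IH
    by (cases "Suc n \<in> A") (simp_all only: simp_thms if_True if_False mult_1_right)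
qed

lemma gf_partitions_into_nth_0: "fps_nth (gf sum_list (partitions_into A)) 0 = 1"
proof -
  have "xs = []" if "xs \<in> partitions_into A" "sum_list xs = 0" for xs
    using that by (cases xs) (auto simp: partitions_into_def is_partition_def)
  then have "{xs \<in> partitions_into A. sum_list xs = 0} = {[]}"
    by (auto simp: partitions_into_def is_partition_def)
  then show ?thesis by (simp add: gf_nth)
qed

text \<open>Parts larger than \<open>n\<close> do not occur in partitions of \<open>j \<le> n\<close>, so each coefficient of the partial
  products is eventually constant.\<close>

lemma has_prod_gf_partitions_into:
  "(\<lambda>m. if 1 \<le> m \<and> m \<in> A then inverse (1 - fps_X ^ m) else 1)
     has_prod gf sum_list (partitions_into A)"
  unfolding has_prod_def raw_has_prod_def add_0_right
proof (intro disjI1 conjI)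
  show "(\<lambda>n. \<Prod>m\<le>n. if 1 \<le> m \<and> m \<in> A then inverse (1 - fps_X ^ m) else 1)
      \<longlonglongrightarrow> gf sum_list (partitions_into A)"
    unfolding gf_partitions_into_bounded
  proof (rule tendsto_fpsI)
    fix j
    have "xs \<in> partitions_into (A \<inter> {1..n}) \<longleftrightarrow> xs \<in> partitions_into A"
      if "j \<le> n" "sum_list xs = j" for n xs
    proof -
      have "x \<le> n" if "x \<in> set xs" for x
        using member_le_sum_list[OF that] \<open>j \<le> n\<close> \<open>sum_list xs = j\<close> by simp
      then show ?thesis
        by (auto simp: partitions_into_def is_partition_def Suc_le_eq)
    qed
    then have "{xs \<in> partitions_into (A \<inter> {1..n}). sum_list xs = j} =
        {xs \<in> partitions_into A. sum_list xs = j}" if "j \<le> n" for n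
      using that by blast
    then show "\<forall>\<^sub>F n in sequentially.
        fps_nth (gf sum_list (partitions_into (A \<inter> {1..n}))) j =
        fps_nth (gf sum_list (partitions_into A)) j"
      unfolding gf_nth by (intro eventually_sequentiallyI[of j]) simp
  qed
  show "gf sum_list (partitions_into A) \<noteq> 0"
    using gf_partitions_into_nth_0[of A] by auto
qed

section \<open>Descents and the forced part of a gapped sequence\<close>

text \<open>Many sequences below satisfy a recursion from right to left; being finally zero gives it a start.\<close>

lemma eventually_zero_induct [consumes 1, case_names zero step]:
  fixes f :: "nat \<Rightarrow> nat"
  assumes "finite {i. f i \<noteq> 0}"
    and "\<And>i. (\<And>j. i \<le> j \<Longrightarrow> f j = 0) \<Longrightarrow> P i"
    and "\<And>i. P (Suc i) \<Longrightarrow> P i"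
  shows "P i"
proof -
  obtain n where n: "\<And>j. f j \<noteq> 0 \<Longrightarrow> j \<le> n"
    using assms(1) by (auto simp: finite_nat_set_iff_bounded_le)
  have "f j = 0" if "Suc (n + i) \<le> j" for j
    using n[of j] that by linarith
  then have "P (Suc (n + i))" by (rule assms(2))
  then show ?thesis
    by (rule inc_induct[rotated 1, where i = i and j = "Suc (n + i)"]) (auto intro: assms(3))
qed

text \<open>Summed over all \<open>i\<close>, these numbers give the major index of the word \<open>s\<close>
  (positions counted from \<open>1\<close>).\<close>

definition descents_from :: "(nat \<Rightarrow> nat) \<Rightarrow> nat \<Rightarrow> nat" where
  "descents_from s i = card {j. i \<le> j \<and> s (Suc j) < s j}"

lemma descents_from_step:
  assumes "finite {j. s j \<noteq> 0}"
  shows "descents_from s i = descents_from s (Suc i) + of_bool (s (Suc i) < s i)"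
proof -
  have "{j. Suc i \<le> j \<and> s (Suc j) < s j} \<subseteq> {j. s j \<noteq> 0}" by auto
  then have fin: "finite {j. Suc i \<le> j \<and> s (Suc j) < s j}"
    using assms by (rule finite_subset)
  have "{j. i \<le> j \<and> s (Suc j) < s j} =
      {j. Suc i \<le> j \<and> s (Suc j) < s j} \<union> (if s (Suc i) < s i then {i} else {})"
    by (auto simp: le_eq_less_or_eq Suc_le_eq)
  then show ?thesis using fin by (simp add: descents_from_def)
qed

lemma descents_from_pos:
  assumes "finite {j. s j \<noteq> 0}" and "s i \<noteq> 0"
  shows "0 < descents_from s i"
proof -
  have "s i \<noteq> 0 \<longrightarrow> 0 < descents_from s i"
    using assms(1)
  proof (induction i rule: eventually_zero_induct)
    case (step i)
    then show ?case using descents_from_step[OF assms(1), of i] by auto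
  qed simp
  then show ?thesis using assms(2) by simp
qed

text \<open>The offset is chosen such that the residues \<open>0, -2, -4\<close> modulo a multiple \<open>N\<close> of \<open>3\<close>, whose
  residues modulo \<open>3\<close> are \<open>0, 1, 2\<close>, are exactly those lifted to multiples of \<open>N\<close>.\<close>

definition lift3 :: "nat \<Rightarrow> nat" where
  "lift3 x = x + 2 * (x mod 3)"

lemma three_dvd_lift3: "3 dvd lift3 x"
  unfolding lift3_def by presburger

definition gapped :: "nat \<Rightarrow> (nat \<Rightarrow> nat) \<Rightarrow> bool" where
  "gapped N f \<longleftrightarrow>
     (\<forall>i. lift3 (f (Suc i)) + N * of_bool (f (Suc i) mod 3 < f i mod 3) \<le> lift3 (f i))"

definition forced :: "nat \<Rightarrow> (nat \<Rightarrow> nat) \<Rightarrow> nat \<Rightarrow> nat" where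
  "forced N f i = N * descents_from (\<lambda>j. f j mod 3) i"

definition surplus :: "nat \<Rightarrow> (nat \<Rightarrow> nat) \<Rightarrow> nat \<Rightarrow> nat" where
  "surplus N f i = lift3 (f i) - forced N f i"

lemma finite_residues:
  fixes f :: "nat \<Rightarrow> nat"
  shows "finite {i. f i \<noteq> 0} \<Longrightarrow> finite {i. f i mod 3 \<noteq> 0}"
  by (erule rev_finite_subset) auto

lemma forced_step:
  assumes "finite {i. f i \<noteq> 0}"
  shows "forced N f i = forced N f (Suc i) + N * of_bool (f (Suc i) mod 3 < f i mod 3)"
  unfolding forced_def
  by (subst descents_from_step[OF finite_residues[OF assms]]) (simp add: algebra_simps)

text \<open>Both sides vanish far out, and one step to the left raises the right side by at least as much as
  the left one.\<close>

lemma forced_le: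
  assumes fin: "finite {i. f i \<noteq> 0}" and gap: "gapped N f"
  shows "forced N f i \<le> lift3 (f i)"
  using fin
proof (induction i rule: eventually_zero_induct)
  case (zero i)
  then have "{j. i \<le> j \<and> f (Suc j) mod 3 < f j mod 3} = {}" by auto
  then show ?case by (simp only: forced_def descents_from_def card.empty)
next
  case (step i)
  then show ?case
    using gap[unfolded gapped_def, rule_format, of i] forced_step[OF fin, of N i] by linarith
qed

text \<open>A nonzero residue must drop to \<open>0\<close> later on, which costs at least one descent. Hence the forced
  amount also covers the offset of the lift, and removing the surplus leaves a natural number.\<close>

lemma twice_residue_le_forced:
  assumes fin: "finite {i. f i \<noteq> 0}" and "4 \<le> N"
  shows "2 * (f i mod 3) \<le> forced N f i"
proof (cases "f i mod 3 = 0")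
  case False
  then have "1 \<le> descents_from (\<lambda>j. f j mod 3) i"
    using descents_from_pos[OF finite_residues[OF fin], of i] by simp
  then have "N * 1 \<le> forced N f i" unfolding forced_def by (rule mult_le_mono2)
  moreover have "f i mod 3 < 3" by simp
  ultimately show ?thesis using assms(2) by linarith
qed simp

section \<open>Trading the surplus\<close>

definition profiles :: "(nat \<Rightarrow> nat) set" where
  "profiles = {f. antimono f \<and> finite {i. f i \<noteq> 0}}"

definition multiple_profiles :: "nat \<Rightarrow> (nat \<Rightarrow> nat) set" where
  "multiple_profiles c = {f \<in> profiles. \<forall>i. c dvd f i}"

text \<open>For \<open>N = 3 k + 3\<close> this covers both sides of the identity: \<open>c = 3\<close> gives the partitions satisfying
  (S), because every lift is a multiple of \<open>3\<close>, and \<open>c = N\<close> gives those into parts \<open>0, -2, -4\<close>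
  modulo \<open>N\<close>.\<close>

definition gapped_profiles :: "nat \<Rightarrow> nat \<Rightarrow> (nat \<Rightarrow> nat) set" where
  "gapped_profiles N c = {f. finite {i. f i \<noteq> 0} \<and> gapped N f \<and> (\<forall>i. c dvd lift3 (f i))}"

lemma gapped_imp_antimono:
  assumes "gapped N f" and "4 \<le> N"
  shows "antimono f"
  unfolding antimono_iff_le_Suc
proof
  fix i
  have "f (Suc i) mod 3 < 3" "f i mod 3 < 3" by simp_all
  then show "f (Suc i) \<le> f i"
    using assms(2) assms(1)[unfolded gapped_def lift3_def, rule_format, of i]
    by (cases "f (Suc i) mod 3 < f i mod 3") simp_all
qed

context
  fixes N c :: nat and f :: "nat \<Rightarrow> nat"
  assumes f: "f \<in> gapped_profiles N c" and N: "4 \<le> N" and c: "3 dvd c" "c dvd N"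
begin

lemma surplus_add_forced: "surplus N f i + forced N f i = lift3 (f i)"
  using f forced_le[of f N i] by (simp add: surplus_def gapped_profiles_def)

lemma surplus_le: "surplus N f i \<le> f i"
  using f twice_residue_le_forced[of f N i] N surplus_add_forced[of i]
  by (simp add: gapped_profiles_def lift3_def)

lemma dvd_surplus: "c dvd surplus N f i"
proof -
  have "c dvd forced N f i" using c(2) by (simp add: forced_def)
  moreover have "c dvd surplus N f i + forced N f i"
    using f by (simp add: surplus_add_forced gapped_profiles_def)
  ultimately show ?thesis using dvd_add_left_iff by blast
qed

lemma surplus_in_multiple_profiles: "surplus N f \<in> multiple_profiles c"
proof -
  have fin: "finite {i. f i \<noteq> 0}" using f by (simp add: gapped_profiles_def)
  have "surplus N f (Suc i) \<le> surplus N f i" for i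
    using f[unfolded gapped_profiles_def gapped_def] forced_step[OF fin, of N i]
      surplus_add_forced[of i] surplus_add_forced[of "Suc i"]
    by (auto dest!: spec[of _ i])
  moreover have "finite {i. surplus N f i \<noteq> 0}"
    using fin by (rule rev_finite_subset) (use surplus_le in \<open>auto simp: neq0_conv intro: less_le_trans\<close>)
  ultimately show ?thesis
    using dvd_surplus by (simp add: multiple_profiles_def profiles_def antimono_iff_le_Suc)
qed

end

text \<open>The word of residues modulo \<open>3\<close> is kept; the surplus of \<open>f\<close> is replaced by \<open>g\<close> and returned.\<close>

definition trade :: "nat \<Rightarrow> (nat \<Rightarrow> nat) \<times> (nat \<Rightarrow> nat) \<Rightarrow> (nat \<Rightarrow> nat) \<times> (nat \<Rightarrow> nat)" where
  "trade N = (\<lambda>(f, g). (\<lambda>i. f i - surplus N f i + g i, surplus N f))"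

text \<open>Both the removed surplus and its replacement consist of multiples of \<open>3\<close>, so the residues and with
  them the forced amounts are unchanged; the new surplus is then \<open>g\<close>.\<close>

lemma trade_props:
  assumes f: "f \<in> gapped_profiles N c" and g: "g \<in> multiple_profiles d"
    and N: "4 \<le> N" and c: "3 dvd c" "c dvd N" and d: "3 dvd d" "d dvd N"
  defines "h \<equiv> \<lambda>i. f i - surplus N f i + g i"
  shows "h \<in> gapped_profiles N d" and "surplus N h = g"
proof -
  note sf = surplus_add_forced[OF f N c] and sl = surplus_le[OF f N c]
  have fin: "finite {i. f i \<noteq> 0}" using f by (simp add: gapped_profiles_def)
  have hg: "h i + surplus N f i = f i + g i" for i
    using sl[of i] by (simp add: h_def)
  have "3 dvd surplus N f i" for i using dvd_surplus[OF f N c] c(1) dvd_trans by blast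
  moreover have "3 dvd g i" for i using g d(1) dvd_trans unfolding multiple_profiles_def by blast
  ultimately have res: "h i mod 3 = f i mod 3" for i
    using hg[of i] by (metis add.right_neutral dvd_imp_mod_0 mod_add_right_eq)
  then have forced: "forced N h = forced N f" by (simp add: forced_def fun_eq_iff)
  have lift: "lift3 (h i) = forced N f i + g i" for i
    using sf[of i] hg[of i] by (simp add: lift3_def res)
  then show "surplus N h = g" by (simp add: surplus_def fun_eq_iff forced)
  have "finite ({i. f i \<noteq> 0} \<union> {i. g i \<noteq> 0})"
    using fin g by (simp add: multiple_profiles_def profiles_def)
  then have "finite {i. h i \<noteq> 0}" by (rule rev_finite_subset) (auto simp: h_def)
  moreover have "gapped N h"
    unfolding gapped_def
  proof
    fix i
    have "g (Suc i) \<le> g i"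
      using g by (simp add: multiple_profiles_def profiles_def antimono_iff_le_Suc)
    then show "lift3 (h (Suc i)) + N * of_bool (h (Suc i) mod 3 < h i mod 3) \<le> lift3 (h i)"
      using forced_step[OF fin, of N i] unfolding lift res by linarith
  qed
  moreover have "d dvd lift3 (h i)" for i
    using g d(2) by (simp add: lift forced_def multiple_profiles_def)
  ultimately show "h \<in> gapped_profiles N d" by (simp add: gapped_profiles_def)
qed

text \<open>The trade undoes itself: the second trade removes the surplus \<open>g\<close> that the first one inserted, and
  puts the original surplus back.\<close>

lemma bij_betw_trade:
  assumes N: "4 \<le> N" and c: "3 dvd c" "c dvd N" and d: "3 dvd d" "d dvd N"
  shows "bij_betw (trade N) (gapped_profiles N c \<times> multiple_profiles d)
    (gapped_profiles N d \<times> multiple_profiles c)"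
proof (rule bij_betw_byWitness[where f' = "trade N"])
  have "trade N (trade N p) = p"
    if p: "p \<in> gapped_profiles N c \<times> multiple_profiles d"
      and c: "3 dvd c" "c dvd N" and d: "3 dvd d" "d dvd N" for p c d
  proof -
    obtain f g where [simp]: "p = (f, g)" and f: "f \<in> gapped_profiles N c" and g: "g \<in> multiple_profiles d"
      using p by auto
    have "surplus N (\<lambda>i. f i - surplus N f i + g i) = g"
      by (rule trade_props(2)[OF f g N c d])
    then show ?thesis
      using surplus_le[OF f N c] by (simp only: trade_def prod.case \<open>p = (f, g)\<close>) simp
  qed
  then show "\<forall>p\<in>gapped_profiles N c \<times> multiple_profiles d. trade N (trade N p) = p"
    and "\<forall>p\<in>gapped_profiles N d \<times> multiple_profiles c. trade N (trade N p) = p"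
    using c d by blast+
  have "trade N ` (gapped_profiles N c \<times> multiple_profiles d)
      \<subseteq> gapped_profiles N d \<times> multiple_profiles c"
    if c: "3 dvd c" "c dvd N" and d: "3 dvd d" "d dvd N" for c d
    using trade_props(1)[OF _ _ N c d] surplus_in_multiple_profiles[OF _ N c]
    by (auto simp: trade_def)
  then show "trade N ` (gapped_profiles N c \<times> multiple_profiles d)
      \<subseteq> gapped_profiles N d \<times> multiple_profiles c"
    and "trade N ` (gapped_profiles N d \<times> multiple_profiles c)
      \<subseteq> gapped_profiles N c \<times> multiple_profiles d"
    using c d by blast+
qed

lemma Sum_any_trade:
  assumes f: "f \<in> gapped_profiles N c" and g: "g \<in> multiple_profiles d"
    and N: "4 \<le> N" and c: "3 dvd c" "c dvd N" and d: "3 dvd d" "d dvd N"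
  shows "(case trade N (f, g) of (h, r) \<Rightarrow> Sum_any h + Sum_any r) = Sum_any f + Sum_any g"
proof -
  let ?h = "\<lambda>i. f i - surplus N f i + g i"
  have fin: "finite {i. f i \<noteq> 0}" "finite {i. g i \<noteq> 0}" "finite {i. ?h i \<noteq> 0}"
    "finite {i. surplus N f i \<noteq> 0}"
    using f g trade_props(1)[OF f g N c d] surplus_in_multiple_profiles[OF f N c]
    unfolding gapped_profiles_def multiple_profiles_def profiles_def by blast+
  have "Sum_any ?h + Sum_any (surplus N f) = Sum_any (\<lambda>i. ?h i + surplus N f i)"
    using fin by (intro Sum_any.distrib[symmetric])
  also have "\<dots> = Sum_any (\<lambda>i. f i + g i)"
    using surplus_le[OF f N c] by (intro arg_cong[of _ _ Sum_any]) (simp add: fun_eq_iff trans_le_add1)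
  also have "\<dots> = Sum_any f + Sum_any g"
    using fin by (intro Sum_any.distrib)
  finally show ?thesis by (simp add: trade_def)
qed

section \<open>Partitions as profiles\<close>

lemma nth_default_neq_0_iff:
  assumes "is_partition xs"
  shows "nth_default 0 xs i \<noteq> 0 \<longleftrightarrow> i < length xs"
  using assms by (auto simp: nth_default_def is_partition_def all_set_conv_all_nth)

lemma nth_default_in_profiles:
  assumes "is_partition xs"
  shows "nth_default 0 xs \<in> profiles"
proof -
  have "nth_default 0 xs (Suc i) \<le> nth_default 0 xs i" for i
    using assms by (simp add: is_partition_def nth_default_def sorted_wrt_iff_nth_less)
  moreover have "finite {i. nth_default 0 xs i \<noteq> 0}" by (rule finite_nth_default_neq_default)
  ultimately show ?thesis unfolding profiles_def antimono_iff_le_Suc by blast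
qed

lemma bij_betw_nth_default: "bij_betw (nth_default 0) {xs. is_partition xs} profiles"
proof (rule bij_betwI')
  fix xs ys :: "nat list" assume "xs \<in> {xs. is_partition xs}" "ys \<in> {xs. is_partition xs}"
  then have p: "is_partition xs" "is_partition ys" by simp_all
  show "(nth_default 0 xs = nth_default 0 ys) = (xs = ys)"
  proof
    assume eq: "nth_default 0 xs = nth_default 0 ys"
    then have "i < length xs \<longleftrightarrow> i < length ys" for i
      using nth_default_neq_0_iff[OF p(1), of i] nth_default_neq_0_iff[OF p(2), of i] by simp
    then have "{..<length xs} = {..<length ys}" by (simp add: set_eq_iff)
    then have "length xs = length ys" by (simp only: lessThan_eq_iff)
    then have "map (nth_default 0 xs) [0..<length xs] = map (nth_default 0 ys) [0..<length ys]"
      by (simp only: eq)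
    then show "xs = ys" by (simp only: map_nth_default)
  qed simp
next
  fix f assume f: "f \<in> profiles"
  then have "\<exists>i. f i = 0"
    using ex_new_if_finite[of "{i. f i \<noteq> 0}"] by (simp add: profiles_def)
  define r where "r = (LEAST i. f i = 0)"
  have r: "f r = 0" unfolding r_def using \<open>\<exists>i. f i = 0\<close> by (rule LeastI_ex)
  have below: "0 < f i" if "i < r" for i
    using that not_less_Least[of i "\<lambda>i. f i = 0"] by (simp add: r_def)
  have anti: "f j \<le> f i" if "i \<le> j" for i j
    using f that by (simp add: profiles_def antimonoD)
  have "is_partition (map f [0..<r])"
    using below anti by (simp add: is_partition_def sorted_wrt_iff_nth_less)
  moreover have "f i = nth_default 0 (map f [0..<r]) i" for i
    using anti[of r i] r by (simp add: nth_default_def)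
  then have "f = nth_default 0 (map f [0..<r])" by (rule ext)
  ultimately show "\<exists>xs\<in>{xs. is_partition xs}. f = nth_default 0 xs" by blast
qed (simp add: nth_default_in_profiles)

lemma Sum_any_nth_default: "Sum_any (nth_default 0 xs) = sum_list xs"
proof -
  have "Sum_any (nth_default 0 xs) = sum (nth_default 0 xs) {..<length xs}"
    by (rule Sum_any.expand_superset) (auto simp: nth_default_def)
  also have "\<dots> = sum_list xs"
    by (simp add: sum_list_sum_nth atLeast0LessThan nth_default_def)
  finally show ?thesis .
qed

lemma gf_profiles:
  assumes "\<And>xs. is_partition xs \<Longrightarrow> P xs \<longleftrightarrow> Q (nth_default 0 xs)"
  shows "gf sum_list {xs. is_partition xs \<and> P xs} = gf Sum_any {f \<in> profiles. Q f}"
proof (rule gf_bij_betw)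
  show "bij_betw (nth_default 0) {xs. is_partition xs \<and> P xs} {f \<in> profiles. Q f}"
    unfolding bij_betw_def
  proof
    show "inj_on (nth_default 0) {xs. is_partition xs \<and> P xs}"
      using bij_betw_imp_inj_on[OF bij_betw_nth_default] by (rule inj_on_subset) auto
    show "nth_default 0 ` {xs. is_partition xs \<and> P xs} = {f \<in> profiles. Q f}"
      using assms unfolding bij_betw_imp_surj_on[OF bij_betw_nth_default, symmetric] by auto
  qed
qed (simp add: Sum_any_nth_default)

lemma finite_profile_fibre:
  assumes "A \<subseteq> profiles"
  shows "finite {f \<in> A. Sum_any f = n}"
proof (rule finite_subset)
  show "{f \<in> A. Sum_any f = n} \<subseteq> nth_default 0 ` partitions n"
  proof
    fix f assume "f \<in> {f \<in> A. Sum_any f = n}"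
    then have f: "f \<in> profiles" "Sum_any f = n" using assms by auto
    then obtain xs where "is_partition xs" "f = nth_default 0 xs"
      using bij_betw_nth_default by (auto simp: bij_betw_def)
    then show "f \<in> nth_default 0 ` partitions n"
      using f by (auto simp: partitions_def Sum_any_nth_default)
  qed
qed (simp add: finite_partitions)

section \<open>The difference conditions as gap conditions\<close>

lemma mem_prog1_iff: "x \<in> prog1 k \<longleftrightarrow> x mod 3 = 1 \<and> x < 3 * k"
proof -
  have "x = 3 * (x div 3) + 1 \<and> x div 3 < k" if "x mod 3 = 1" "x < 3 * k"
    using that mult_div_mod_eq[of 3 x] by linarith
  moreover have "x mod 3 = 1 \<and> x < 3 * k" if "x = 3 * j + 1" "j < k" for j
    using that by presburger
  ultimately show ?thesis unfolding prog1_def by blast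
qed

lemma mem_prog2_iff: "x \<in> prog2 k \<longleftrightarrow> x mod 3 = 2 \<and> x + 1 < 3 * k"
proof -
  have "x = 3 * (x div 3) + 2 \<and> x div 3 < k - 1" if "x mod 3 = 2" "x + 1 < 3 * k"
    using that mult_div_mod_eq[of 3 x] by linarith
  moreover have "x mod 3 = 2 \<and> x + 1 < 3 * k" if "x = 3 * j + 2" "j < k - 1" for j
    using that by presburger
  ultimately show ?thesis unfolding prog2_def by blast
qed

lemma mem_prog4_iff: "x \<in> prog4 k \<longleftrightarrow> x mod 3 = 1 \<and> x \<noteq> 1 \<and> x < 3 * k"
proof -
  have "x = 3 * (x div 3) + 1 \<and> 1 \<le> x div 3 \<and> x div 3 < k"
    if "x mod 3 = 1" "x \<noteq> 1" "x < 3 * k"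
    using that mult_div_mod_eq[of 3 x] by linarith
  moreover have "x mod 3 = 1 \<and> x \<noteq> 1 \<and> x < 3 * k" if "x = 3 * j + 1" "1 \<le> j" "j < k" for j
    using that by presburger
  moreover have "x \<in> prog4 k \<longleftrightarrow> (\<exists>j. x = 3 * j + 1 \<and> 1 \<le> j \<and> j < k)"
    by (auto simp: prog4_def)
  ultimately show ?thesis by blast
qed

text \<open>The condition common to (S) and (C): \<open>d\<close> is a difference of adjacent parts with smaller part \<open>b\<close>,
  or a frequency of a part with \<open>b\<close> greater parts.\<close>

definition admissible_step :: "nat \<Rightarrow> nat \<Rightarrow> nat \<Rightarrow> bool" where
  "admissible_step k d b \<longleftrightarrow>
     d \<noteq> 1 \<and> (d \<in> prog2 k \<longrightarrow> \<not> [b = 0] (mod 3)) \<and> (d \<in> prog4 k \<longrightarrow> [b = 2] (mod 3))"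

lemma admissible_step_0: "admissible_step k 0 b"
  by (simp add: admissible_step_def mem_prog2_iff mem_prog4_iff)

text \<open>With \<open>d = a - b\<close>, a residue that rises by \<open>1\<close> (resp. \<open>2\<close>) from \<open>b\<close> to \<open>a\<close> needs \<open>d \<ge> 3 k + 1\<close>
  (resp. \<open>d \<ge> 3 k - 1\<close>), which is \<open>d \<ge> N - 2\<close> (resp. \<open>d \<ge> N - 4\<close>); a residue that falls by \<open>2\<close> needs
  \<open>d \<ge> 4\<close>, that is \<open>d \<noteq> 1\<close>. The remaining cases hold for every \<open>d\<close> of the given residue.\<close>

lemma admissible_step_iff:
  assumes "1 \<le> k" and "b \<le> a"
  shows "admissible_step k (a - b) b \<longleftrightarrow>
    lift3 b + (3 * k + 3) * of_bool (b mod 3 < a mod 3) \<le> lift3 a"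
proof -
  define d D where "d = a - b" and "D = d div 3"
  have a: "a = b + d" using assms(2) by (simp add: d_def)
  have D: "3 * D + d mod 3 = d" by (simp add: D_def)
  have am: "a mod 3 = (b mod 3 + d mod 3) mod 3" unfolding a by (simp add: mod_add_eq)
  have adm: "admissible_step k d b \<longleftrightarrow> d \<noteq> 1 \<and>
      (d mod 3 = 2 \<and> d + 1 < 3 * k \<longrightarrow> b mod 3 \<noteq> 0) \<and>
      (d mod 3 = 1 \<and> d \<noteq> 1 \<and> d < 3 * k \<longrightarrow> b mod 3 = 2)"
    by (simp add: admissible_step_def mem_prog2_iff mem_prog4_iff cong_def)
  have ineq: "lift3 b + (3 * k + 3) * of_bool (b mod 3 < a mod 3) \<le> lift3 a \<longleftrightarrow>
      2 * (b mod 3) + (if b mod 3 < a mod 3 then 3 * k + 3 else 0) \<le> d + 2 * (a mod 3)"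
    unfolding lift3_def using a by auto
  consider "d mod 3 = 0" | "d mod 3 = 1" | "d mod 3 = 2" by linarith
  then have "admissible_step k d b \<longleftrightarrow>
      2 * (b mod 3) + (if b mod 3 < a mod 3 then 3 * k + 3 else 0) \<le> d + 2 * (a mod 3)"
  proof cases
    case 1
    then show ?thesis unfolding adm am by auto
  next
    case 2
    then have d: "d = 3 * D + 1" using D by linarith
    consider "b mod 3 = 0" | "b mod 3 = 1" | "b mod 3 = 2" by linarith
    then show ?thesis
    proof cases
      case 1
      show ?thesis unfolding adm am \<open>d mod 3 = 1\<close> 1 using d assms(1) by (simp; arith?)
    next
      case 2
      show ?thesis unfolding adm am \<open>d mod 3 = 1\<close> 2 using d assms(1) by (simp; arith?)
    next
      case 3
      show ?thesis unfolding adm am \<open>d mod 3 = 1\<close> 3 using d assms(1) by (simp; arith?)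
    qed
  next
    case 3
    then have d: "d = 3 * D + 2" using D by linarith
    consider "b mod 3 = 0" | "b mod 3 = 1" | "b mod 3 = 2" by linarith
    then show ?thesis
    proof cases
      case 1
      show ?thesis unfolding adm am \<open>d mod 3 = 2\<close> 1 using d assms(1) by (simp; arith?)
    next
      case 2
      show ?thesis unfolding adm am \<open>d mod 3 = 2\<close> 2 using d assms(1) by (simp; arith?)
    next
      case 3
      show ?thesis unfolding adm am \<open>d mod 3 = 2\<close> 3 using d assms(1) by (simp; arith?)
    qed
  qed
  then show ?thesis by (simp only: ineq d_def)
qed

text \<open>The initial condition concerns all parts, whereas the fictitious zero only constrains the last one.
  The forbidden values propagate along admissible steps: after an
  admissible step down from a forbidden value the next value is forbidden again, which cannot go on,
  because the zeros at the end are not forbidden.\<close>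

lemma admissible_step_no_initial:
  assumes "admissible_step k (a - b) b" and "b \<le> a" and "b \<notin> prog1 k \<union> prog2 k"
  shows "a \<notin> prog1 k \<union> prog2 k"
proof -
  define d where "d = a - b"
  have d: "a = b + d" "d mod 3 \<le> d" using assms(2) by (simp_all add: d_def)
  have "b mod 3 = 0 \<or> b mod 3 = 1 \<or> b mod 3 = 2" and "d mod 3 = 0 \<or> d mod 3 = 1 \<or> d mod 3 = 2"
    by linarith+
  moreover have "a mod 3 = (b mod 3 + d mod 3) mod 3" unfolding d(1) by (simp add: mod_add_eq)
  ultimately show ?thesis
    using assms(1,3) d
    unfolding admissible_step_def Un_iff mem_prog1_iff mem_prog2_iff mem_prog4_iff cong_def
      d_def[symmetric]
    by (elim disjE) (simp_all, linarith+)
qed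

lemma cond_S_iff_steps:
  assumes k: "1 \<le> k" and xs: "is_partition xs"
  defines "f \<equiv> nth_default 0 xs"
  shows "cond_S k xs \<longleftrightarrow> (\<forall>i. admissible_step k (f i - f (Suc i)) (f (Suc i)))"
proof
  assume S: "cond_S k xs"
  show "\<forall>i. admissible_step k (f i - f (Suc i)) (f (Suc i))"
  proof
    fix i
    consider "Suc i < length xs" | "Suc i = length xs" | "length xs \<le> i" by linarith
    then show "admissible_step k (f i - f (Suc i)) (f (Suc i))"
    proof cases
      case 1
      then show ?thesis using S by (simp add: f_def nth_default_nth cond_S_def admissible_step_def)
    next
      case 2
      then have "f i \<in> set xs" and "f (Suc i) = 0" by (simp_all add: f_def nth_default_def)
      then have "f i \<notin> prog1 k" "f i \<notin> prog2 k" using S by (simp_all add: cond_S_def)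
      then show ?thesis using k \<open>f (Suc i) = 0\<close>
        by (auto simp: admissible_step_def mem_prog1_iff mem_prog2_iff mem_prog4_iff)
    next
      case 3
      then show ?thesis by (simp add: f_def nth_default_beyond admissible_step_0)
    qed
  qed
next
  assume steps: "\<forall>i. admissible_step k (f i - f (Suc i)) (f (Suc i))"
  have f: "f \<in> profiles" unfolding f_def using xs by (rule nth_default_in_profiles)
  then have "finite {i. f i \<noteq> 0}" by (simp add: profiles_def)
  then have no: "f i \<notin> prog1 k \<union> prog2 k" for i
  proof (induction i rule: eventually_zero_induct)
    case (zero i)
    then show ?case by (simp add: mem_prog1_iff mem_prog2_iff)
  next
    case (step i)
    then show ?case
      using steps f by (intro admissible_step_no_initial[of k "f i" "f (Suc i)"])
        (simp_all add: profiles_def antimono_iff_le_Suc)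
  qed
  show "cond_S k xs"
    unfolding cond_S_def
  proof (intro conjI allI impI ballI)
    fix x assume "x \<in> set xs"
    then obtain i where "x = f i" by (metis f_def in_set_conv_nth nth_default_nth)
    then show "x \<notin> prog1 k" and "x \<notin> prog2 k" using no[of i] by simp_all
  next
    fix i assume i: "Suc i < length xs"
    have *: "xs ! i = f i" "xs ! Suc i = f (Suc i)" using i by (simp_all add: f_def nth_default_nth)
    note st = steps[rule_format, of i, unfolded admissible_step_def]
    show "xs ! i - xs ! Suc i \<noteq> 1" using st by (simp add: *)
    show "\<not> [xs ! Suc i = 0] (mod 3)" if "xs ! i - xs ! Suc i \<in> prog2 k"
      using st that by (simp add: *)
    show "[xs ! Suc i = 2] (mod 3)" if "xs ! i - xs ! Suc i \<in> prog4 k"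
      using st that by (simp add: *)
  qed
qed

lemma cond_S_iff_gapped:
  assumes k: "1 \<le> k" and xs: "is_partition xs"
  shows "cond_S k xs \<longleftrightarrow> gapped (3 * k + 3) (nth_default 0 xs)"
  using nth_default_in_profiles[OF xs]
  unfolding cond_S_iff_steps[OF assms] gapped_def profiles_def
  by (simp add: admissible_step_iff[OF k] antimono_iff_le_Suc)

section \<open>Conjugation\<close>

lemma num_greater_conjugate:
  assumes "is_partition xs"
  shows "num_greater (conjugate xs) x = nth_default 0 xs x"
proof -
  have "num_greater (conjugate xs) x = card {j. (j, x) \<in> cells (conjugate xs)}"
    by (simp add: num_greater_def length_filter_conv_card cells_def)
  also have "{j. (j, x) \<in> cells (conjugate xs)} = {..<nth_default 0 xs x}"
    unfolding ferrers_conjugate(2)[OF assms] by (auto simp: cells_def nth_default_def)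
  finally show ?thesis by simp
qed

lemma num_greater_Suc: "num_greater ys i = num_greater ys (Suc i) + count_list ys (Suc i)"
  by (induction ys) (auto simp: num_greater_def)

lemma cond_C_iff_steps:
  assumes "is_partition ys"
  shows "cond_C k ys \<longleftrightarrow>
    (\<forall>i. admissible_step k (num_greater ys i - num_greater ys (Suc i)) (num_greater ys (Suc i)))"
proof -
  have "num_greater ys i - num_greater ys (Suc i) = count_list ys (Suc i)" for i
    using num_greater_Suc[of ys i] by simp
  moreover have "(\<forall>x\<in>set ys. admissible_step k (count_list ys x) (num_greater ys x)) \<longleftrightarrow>
      (\<forall>i. admissible_step k (count_list ys (Suc i)) (num_greater ys (Suc i)))"
  proof safe
    fix i
    assume "\<forall>x\<in>set ys. admissible_step k (count_list ys x) (num_greater ys x)"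
    then show "admissible_step k (count_list ys (Suc i)) (num_greater ys (Suc i))"
      by (cases "Suc i \<in> set ys") (simp_all add: admissible_step_0)
  next
    fix x
    assume "\<forall>i. admissible_step k (count_list ys (Suc i)) (num_greater ys (Suc i))"
      and "x \<in> set ys"
    moreover have "x = Suc (x - 1)" using assms \<open>x \<in> set ys\<close> by (simp add: is_partition_def)
    ultimately show "admissible_step k (count_list ys x) (num_greater ys x)" by metis
  qed
  ultimately show ?thesis by (simp add: cond_C_def admissible_step_def)
qed

lemma cond_S_iff_cond_C_conjugate:
  assumes "1 \<le> k" and "is_partition xs"
  shows "cond_S k xs \<longleftrightarrow> cond_C k (conjugate xs)"
  by (simp add: cond_S_iff_steps[OF assms] num_greater_conjugate[OF assms(2)]
      cond_C_iff_steps[OF ferrers_conjugate(1)[OF assms(2)]])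

section \<open>The identity of generating functions\<close>

lemma allowed_part_iff: "allowed_part k m \<longleftrightarrow> 3 dvd m \<or> 3 * k + 3 dvd lift3 m"
proof -
  have int_dvd: "[int m = - int r] (mod (3 * int k + 3)) \<longleftrightarrow> 3 * k + 3 dvd m + r" for r
  proof -
    have "[int m = - int r] (mod (3 * int k + 3)) \<longleftrightarrow> int (3 * k + 3) dvd int (m + r)"
      by (simp add: cong_iff_dvd_diff)
    then show ?thesis by (simp only: int_dvd_int_iff)
  qed
  have three: "3 dvd x" if "3 * k + 3 dvd x" for x :: nat
  proof -
    have "3 dvd 3 * (k + 1)" by (rule dvd_triv_left)
    then show ?thesis using dvd_trans[OF _ that] by simp
  qed
  have "allowed_part k m \<longleftrightarrow> 3 dvd m \<or> 3 * k + 3 dvd m + 4 \<or> 3 * k + 3 dvd m + 2"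
    using int_dvd[of 4] int_dvd[of 2] by (simp add: allowed_part_def)
  moreover consider "m mod 3 = 0" | "m mod 3 = 1" | "m mod 3 = 2" by linarith
  then have "3 dvd m \<or> 3 * k + 3 dvd m + 4 \<or> 3 * k + 3 dvd m + 2 \<longleftrightarrow>
      3 dvd m \<or> 3 * k + 3 dvd lift3 m"
  proof cases
    case 1
    then show ?thesis by (simp add: dvd_eq_mod_eq_0)
  next
    case 2
    then have "\<not> 3 dvd m + 4" by presburger
    then have "\<not> 3 * k + 3 dvd m + 4" using three by blast
    then show ?thesis by (simp only: lift3_def 2 simp_thms mult_1_right)
  next
    case 3
    then have "\<not> 3 dvd m + 2" by presburger
    then have "\<not> 3 * k + 3 dvd m + 2" using three by blast
    moreover have "lift3 m = m + 4" by (simp add: lift3_def 3)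
    ultimately show ?thesis by (simp only: simp_thms)
  qed
  ultimately show ?thesis by (simp only:)
qed

text \<open>The lifts of the entries are multiples of \<open>N\<close>, and passing from \<open>f i \<ge> f (Suc i)\<close> to the lifts can lose
  at most \<open>4 < N\<close>, hence loses nothing. A descent of residues makes the inequality of lifts strict, and
  then it has a gap of at least \<open>N\<close>.\<close>

lemma gapped_if_dvd_lift3:
  assumes "antimono f" and "5 \<le> N" and dvd: "\<And>i. N dvd lift3 (f i)"
  shows "gapped N f"
  unfolding gapped_def
proof
  fix i
  obtain A B where A: "lift3 (f i) = N * A" and B: "lift3 (f (Suc i)) = N * B"
    using dvd by (metis dvdE)
  have le: "f (Suc i) \<le> f i" using assms(1) by (simp add: antimono_iff_le_Suc)
  have "f (Suc i) mod 3 \<le> 2" by linarith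
  then have "N * B < N * (A + 1)"
    using le assms(2) unfolding lift3_def A[symmetric] B[symmetric] distrib_left by linarith
  then have "B < A + 1" unfolding mult_less_cancel1 by blast
  then have "B \<le> A" by simp
  show "lift3 (f (Suc i)) + N * of_bool (f (Suc i) mod 3 < f i mod 3) \<le> lift3 (f i)"
  proof (cases "f (Suc i) mod 3 < f i mod 3")
    case True
    then have "N * B < N * A"
      using le unfolding A[symmetric] B[symmetric] lift3_def by linarith
    then have "B + 1 \<le> A" by simp
    then have "N * (B + 1) \<le> N * A" by (rule mult_le_mono2)
    then show ?thesis using True by (simp add: A B)
  next
    case False
    then show ?thesis using \<open>B \<le> A\<close> by (simp add: A B)
  qed
qed

lemma gf_partitions_into_dvd:
  assumes "c dvd w 0"
  shows "gf sum_list (partitions_into {m. c dvd w m}) =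
    gf Sum_any {f \<in> profiles. \<forall>i. c dvd w (f i)}"
  unfolding partitions_into_def
proof (rule gf_profiles)
  fix xs
  show "set xs \<subseteq> {m. c dvd w m} \<longleftrightarrow> (\<forall>i. c dvd w (nth_default 0 xs i))"
    using assms by (auto simp: nth_default_def in_set_conv_nth dest!: subsetD[OF _ nth_mem])
qed

lemma gf_trade:
  assumes N: "4 \<le> N" and c: "3 dvd c" "c dvd N" and d: "3 dvd d" "d dvd N"
  shows "gf Sum_any (gapped_profiles N c) * gf Sum_any (multiple_profiles d) =
    gf Sum_any (gapped_profiles N d) * gf Sum_any (multiple_profiles c)"
proof -
  have "gapped_profiles N c \<subseteq> profiles" "multiple_profiles c \<subseteq> profiles" for c
    using N gapped_imp_antimono
    by (auto simp: gapped_profiles_def multiple_profiles_def profiles_def)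
  then have fin: "finite {f \<in> gapped_profiles N c. Sum_any f = n}"
      "finite {f \<in> multiple_profiles c. Sum_any f = n}" for c n
    by (blast intro: finite_profile_fibre)+
  have "gf (\<lambda>(f, g). Sum_any f + Sum_any g) (gapped_profiles N c \<times> multiple_profiles d) =
      gf (\<lambda>(f, g). Sum_any f + Sum_any g) (gapped_profiles N d \<times> multiple_profiles c)"
    using bij_betw_trade[OF assms] by (rule gf_bij_betw) (use Sum_any_trade[OF _ _ assms] in auto)
  then show ?thesis by (simp only: gf_times[OF fin])
qed

text \<open>Here \<open>R\<close> collects the parts \<open>-2, -4\<close> modulo \<open>N\<close>. Multiplying both sides by the generating function
  of the multiples of \<open>N\<close> completes \<open>R\<close> to all of the classes \<open>0, -2, -4\<close>, to which the trade applies.\<close>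

lemma gf_cond_S_eq_gf_cond_P:
  assumes k: "1 \<le> k"
  shows "gf sum_list {xs. is_partition xs \<and> cond_S k xs} =
    gf sum_list (partitions_into {m. allowed_part k m})"
proof -
  define N where "N = 3 * k + 3"
  have N: "5 \<le> N" "3 dvd N" using k by (simp_all add: N_def)
  define R where "R = {m. N dvd lift3 m \<and> \<not> 3 dvd m}"
  let ?G = "\<lambda>A. gf sum_list (partitions_into A)"
  have lift3_mult: "lift3 m = m" if "3 dvd m" for m using that by (simp add: lift3_def)
  have "{m. allowed_part k m} = {m. 3 dvd m} \<union> R"
    by (auto simp: allowed_part_iff R_def N_def)
  then have P: "?G {m. allowed_part k m} = ?G {m. 3 dvd m} * ?G R"
    by (simp only:) (rule gf_partitions_into_Un, auto simp: R_def)
  have "{m. N dvd lift3 m} = R \<union> {m. N dvd m}"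
  proof -
    have "N dvd lift3 m \<longleftrightarrow> N dvd m" if "3 dvd m" for m using that by (simp add: lift3_mult)
    moreover have "3 dvd m" if "N dvd m" for m using N(2) that by (rule dvd_trans)
    ultimately show ?thesis unfolding R_def by blast
  qed
  moreover have "R \<inter> {m. N dvd m} = {}" using dvd_trans[OF N(2)] by (auto simp: R_def)
  ultimately have L: "?G {m. N dvd lift3 m} = ?G R * ?G {m. N dvd m}"
    by (simp only: gf_partitions_into_Un)
  have T: "?G {m. c dvd m} = gf Sum_any (multiple_profiles c)" for c
    using gf_partitions_into_dvd[of c "\<lambda>m. m"] by (simp add: multiple_profiles_def)
  have "{f \<in> profiles. \<forall>i. N dvd lift3 (f i)} = gapped_profiles N N"
    using gapped_if_dvd_lift3[OF _ N(1)] gapped_imp_antimono[of N] N(1)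
    by (auto simp: gapped_profiles_def profiles_def)
  then have Q: "?G {m. N dvd lift3 m} = gf Sum_any (gapped_profiles N N)"
    using gf_partitions_into_dvd[of N lift3] by (simp add: lift3_def)
  have "{f \<in> profiles. gapped N f} = gapped_profiles N 3"
    using gapped_imp_antimono[of N] N(1) three_dvd_lift3
    by (auto simp: gapped_profiles_def profiles_def)
  then have S: "gf sum_list {xs. is_partition xs \<and> cond_S k xs} = gf Sum_any (gapped_profiles N 3)"
    using gf_profiles[of "cond_S k" "gapped N"] cond_S_iff_gapped[OF k] by (simp add: N_def)
  have "gf sum_list {xs. is_partition xs \<and> cond_S k xs} * ?G {m. N dvd m} =
      ?G {m. N dvd lift3 m} * ?G {m. 3 dvd m}"
    unfolding S T Q using N by (intro gf_trade) auto
  also have "\<dots> = ?G {m. allowed_part k m} * ?G {m. N dvd m}"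
    by (simp only: P L ac_simps)
  finally show ?thesis
    using gf_partitions_into_nth_0[of "{m. N dvd m}"] by auto
qed

theorem mainTheorem2:
  fixes k :: nat
  assumes "1 \<le> k"
  shows "(\<forall>n. card {xs \<in> partitions n. cond_P k xs} = card {xs \<in> partitions n. cond_S k xs})
    \<and> (\<lambda>m. if 1 \<le> m \<and> allowed_part k m then inverse (1 - fps_X ^ m) else 1)
        has_prod (Abs_fps (\<lambda>n. of_nat (card {xs \<in> partitions n. cond_P k xs})) :: rat fps)
    \<and> (\<forall>xs. is_partition xs \<longrightarrow> (cond_S k xs \<longleftrightarrow> cond_C k (conjugate xs)))"
proof (intro conjI allI impI)
  let ?P = "partitions_into {m. allowed_part k m}"
  have P: "{xs \<in> partitions n. cond_P k xs} = {xs \<in> ?P. sum_list xs = n}" for n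
    by (auto simp: partitions_def partitions_into_def cond_P_def)
  show "card {xs \<in> partitions n. cond_P k xs} = card {xs \<in> partitions n. cond_S k xs}" for n
  proof -
    have "{xs \<in> partitions n. cond_S k xs} =
        {xs \<in> {xs. is_partition xs \<and> cond_S k xs}. sum_list xs = n}"
      by (auto simp: partitions_def)
    moreover have "(of_nat (card {xs \<in> ?P. sum_list xs = n}) :: rat) =
        of_nat (card {xs \<in> {xs. is_partition xs \<and> cond_S k xs}. sum_list xs = n})"
      by (simp only: gf_nth[symmetric] gf_cond_S_eq_gf_cond_P[OF assms])
    ultimately show ?thesis by (simp only: P of_nat_eq_iff)
  qed
  have "Abs_fps (\<lambda>n. of_nat (card {xs \<in> partitions n. cond_P k xs})) = gf sum_list ?P"
    by (simp only: P gf_def)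
  then show "(\<lambda>m. if 1 \<le> m \<and> allowed_part k m then inverse (1 - fps_X ^ m) else 1)
      has_prod (Abs_fps (\<lambda>n. of_nat (card {xs \<in> partitions n. cond_P k xs})) :: rat fps)"
    using has_prod_gf_partitions_into[of "{m. allowed_part k m}"] by (simp only: mem_Collect_eq)
  show "cond_S k xs \<longleftrightarrow> cond_C k (conjugate xs)" if "is_partition xs" for xs
    using assms that by (rule cond_S_iff_cond_C_conjugate)
qed

end
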